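(* Let $\mathcal{S}$ be a class of probability measures, each on $\{0,1\}^E$ for some nonempty finite index set $E$ (depending on the measure), and suppose $\mathcal{S}$ is closed under conditioning and under projection. Suppose that every $\mu\in\mathcal{S}$ has pairwise negative correlations: if $\mu$ is a measure on $\{0,1\}^E$, then for all distinct $e,f\in E$, $\int X_eX_f\,d\mu\le \int X_e\,d\mu\int X_f\,d\mu$. Suppose moreover that $\mathcal{S}$ has the following property: for each $\mu\in\mathcal{S}$ on $\{0,1\}^E$ and each increasing event $A\subseteq\{0,1\}^E$ there is an $e\in E$ with $\int X_e\mathbf{1}_A\,d\mu\ge \left(\int X_e\,d\mu\right)\mu(A)$. Then every measure in $\mathcal{S}$ is negatively associated.
   Context: For $e\in E$, $X_e:\{0,1\}^E\to\{0,1\}$ denotes the coordinate function. $\{0,1\}^E$ carries the coordinatewise partial order; an event $A\subseteq\{0,1\}^E$ is increasing (an up-set) if $x\in A$ and $y\ge x$ imply $y\in A$. All inequalities are weak (e.g. "negatively correlated" means non-positively correlated). Closed under conditioning: if $\mu\in\mathcal{S}$ is a measure on $\{0,1\}^E$, $B\subsetneq E$ and $\eta\in\{0,1\}^B$ with $\mu(X_e=\eta(e)\ \forall e\in B)>0$, then the conditional law of $(X_e)_{e\in E\setminus B}$ given $X_e=\eta(e)$ for all $e\in B$ is in $\mathcal{S}$. Closed under projection: if $\mu\in\mathcal{S}$ is a measure on $\{0,1\}^E$ and $\emptyset\ne E'\subseteq E$, then the law of $(X_e)_{e\in E'}$ under $\mu$ (forgetting the other variables) is in $\mathcal{S}$.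 A probability measure $\mu$ on $\{0,1\}^E$ is negatively associated if for every $B\subseteq E$ and every pair of increasing functions $f,g$ with $f$ depending only on the coordinates in $B$ and $g$ depending only on the coordinates in $E\setminus B$, $\int fg\,d\mu\le\int f\,d\mu\int g\,d\mu$. *)

theory Defs
  imports "HOL-Probability.Probability"
begin

text \<open>
  The cube of all 0-1 configurations on \<open>E\<close>. Configurations are extensional functions (they are
  \<open>undefined\<close> outside \<open>E\<close>), so the pointwise order \<open>\<le>\<close> of the function type, restricted to
  \<open>cube E\<close>, is the coordinatewise order, and the coordinate function of \<open>e\<close> is \<open>\<lambda>x. x e\<close>.
\<close>

definition cube :: "'i set \<Rightarrow> ('i \<Rightarrow> real) set" where
  "cube E = (E \<rightarrow>\<^sub>E {0, 1})"

definition prob_on_cube :: "'i set \<Rightarrow> ('i \<Rightarrow> real) measure \<Rightarrow> bool" where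
  "prob_on_cube E \<mu> \<longleftrightarrow> prob_space \<mu> \<and> space \<mu> = cube E \<and> sets \<mu> = Pow (cube E)"

definition increasing_event :: "'i set \<Rightarrow> ('i \<Rightarrow> real) set \<Rightarrow> bool" where
  "increasing_event E A \<longleftrightarrow>
     A \<subseteq> cube E \<and> (\<forall>x\<in>A. \<forall>y\<in>cube E. x \<le> y \<longrightarrow> y \<in> A)"

definition depends_only_on :: "'i set \<Rightarrow> 'i set \<Rightarrow> (('i \<Rightarrow> real) \<Rightarrow> real) \<Rightarrow> bool" where
  "depends_only_on E B f \<longleftrightarrow>
     (\<forall>x\<in>cube E. \<forall>y\<in>cube E. (\<forall>e\<in>B. x e = y e) \<longrightarrow> f x = f y)"

definition projected_law :: "'i set \<Rightarrow> ('i \<Rightarrow> real) measure \<Rightarrow> ('i \<Rightarrow> real) measure" where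
  "projected_law E' \<mu> = distr \<mu> (count_space (cube E')) (\<lambda>x. restrict x E')"

definition agree_event ::
    "('i \<Rightarrow> real) measure \<Rightarrow> 'i set \<Rightarrow> ('i \<Rightarrow> real) \<Rightarrow> ('i \<Rightarrow> real) set" where
  "agree_event \<mu> B \<eta> = {x \<in> space \<mu>. \<forall>e\<in>B. x e = \<eta> e}"

text \<open>
  \<open>uniform_measure \<mu> C\<close> is \<open>\<mu>\<close> conditioned on the event \<open>C\<close>, that is
  \<open>D \<mapsto> \<mu> (C \<inter> D) / \<mu> C\<close>.
\<close>

definition conditional_law ::
    "'i set \<Rightarrow> ('i \<Rightarrow> real) measure \<Rightarrow> 'i set \<Rightarrow> ('i \<Rightarrow> real) \<Rightarrow> ('i \<Rightarrow> real) measure" where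
  "conditional_law E \<mu> B \<eta> = projected_law (E - B) (uniform_measure \<mu> (agree_event \<mu> B \<eta>))"

text \<open>
  A class of measures is given by a family \<open>S\<close>, where \<open>S E\<close> is the set of those members of the
  class that are measures on \<open>cube E\<close>.
\<close>

definition closed_under_conditioning :: "('i set \<Rightarrow> ('i \<Rightarrow> real) measure set) \<Rightarrow> bool" where
  "closed_under_conditioning S \<longleftrightarrow>
     (\<forall>E. \<forall>\<mu>\<in>S E. \<forall>B. B \<subset> E \<longrightarrow>
        (\<forall>\<eta>\<in>cube B. measure \<mu> (agree_event \<mu> B \<eta>) > 0 \<longrightarrow>
           conditional_law E \<mu> B \<eta> \<in> S (E - B)))"

definition closed_under_projection :: "('i set \<Rightarrow> ('i \<Rightarrow> real) measure set) \<Rightarrow> bool" where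
  "closed_under_projection S \<longleftrightarrow>
     (\<forall>E. \<forall>\<mu>\<in>S E. \<forall>E'. E' \<noteq> {} \<and> E' \<subseteq> E \<longrightarrow> projected_law E' \<mu> \<in> S E')"

definition pairwise_negative_correlations :: "'i set \<Rightarrow> ('i \<Rightarrow> real) measure \<Rightarrow> bool" where
  "pairwise_negative_correlations E \<mu> \<longleftrightarrow>
     (\<forall>e\<in>E. \<forall>f\<in>E. e \<noteq> f \<longrightarrow>
        (\<integral>x. x e * x f \<partial>\<mu>) \<le> (\<integral>x. x e \<partial>\<mu>) * (\<integral>x. x f \<partial>\<mu>))"

definition negatively_associated :: "'i set \<Rightarrow> ('i \<Rightarrow> real) measure \<Rightarrow> bool" where
  "negatively_associated E \<mu> \<longleftrightarrow>
     (\<forall>B f g. B \<subseteq> E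
        \<and> mono_on (cube E) f \<and> depends_only_on E B f
        \<and> mono_on (cube E) g \<and> depends_only_on E (E - B) g \<longrightarrow>
        (\<integral>x. f x * g x \<partial>\<mu>) \<le> (\<integral>x. f x \<partial>\<mu>) * (\<integral>x. g x \<partial>\<mu>))"

end

theory Submission imports Defs begin

text \<open>
  Let \<open>f\<close> be the indicator of an increasing event depending on \<open>B\<close>. Applied to the projection to \<open>B\<close>,
  the hypothesis on increasing events yields \<open>e \<in> B\<close> with \<open>cov X\<^sub>e f \<ge> 0\<close>. Conditioning on
  \<open>X\<^sub>e\<close>, the law of total covariance writes \<open>cov f g\<close> as an average of conditional covariances, which
  are nonpositive by induction on \<open>card E\<close>, plus \<open>cov X\<^sub>e f * cov X\<^sub>e g / var X\<^sub>e\<close>. So it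
  suffices that \<open>cov X\<^sub>e g \<le> 0\<close>. When \<open>g\<close> is itself a coordinate function this is pairwise
  negative correlation; that instance of the argument in turn provides \<open>cov X\<^sub>e g \<le> 0\<close> for
  every increasing event not depending on \<open>e\<close>, hence the claim for pairs of increasing events. General
  increasing functions are handled by the layer-cake decomposition.
\<close>

section \<open>Covariance and integrals on a finite cube\<close>

definition cov :: "'a measure \<Rightarrow> ('a \<Rightarrow> real) \<Rightarrow> ('a \<Rightarrow> real) \<Rightarrow> real" where
  "cov M f g = (\<integral>x. f x * g x \<partial>M) - (\<integral>x. f x \<partial>M) * (\<integral>x. g x \<partial>M)"

lemma cov_commute: "cov M f g = cov M g f"
  by (simp add: cov_def mult.commute)

lemma cov_cong:
  assumes "\<And>x. x \<in> space M \<Longrightarrow> f x = f' x" "\<And>x. x \<in> space M \<Longrightarrow> g x = g' x"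
  shows "cov M f g = cov M f' g'"
  using assms by (simp add: cov_def cong: Bochner_Integration.integral_cong)

lemma cov_const_left:
  assumes "prob_space M"
  shows "cov M (\<lambda>x. c) g = 0"
proof -
  interpret prob_space M by fact
  show ?thesis by (simp add: cov_def prob_space)
qed

lemma finite_cube: "finite E \<Longrightarrow> finite (cube E)"
  by (simp add: cube_def finite_PiE)

lemma restrict_in_cube: "x \<in> cube E \<Longrightarrow> E' \<subseteq> E \<Longrightarrow> restrict x E' \<in> cube E'"
  by (auto simp: cube_def PiE_iff)

lemma cube_values: "x \<in> cube E \<Longrightarrow> e \<in> E \<Longrightarrow> x e = 0 \<or> x e = 1"
  by (auto simp: cube_def PiE_iff)

text \<open>On a finite space whose subsets are all measurable, every function is measurable and
  bounded, so the integrals below can be split freely.\<close>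

lemma integrable_cube:
  fixes f :: "('i \<Rightarrow> real) \<Rightarrow> real"
  assumes "finite E" "prob_on_cube E \<mu>"
  shows "integrable \<mu> f"
proof -
  interpret prob_space \<mu> using assms by (simp add: prob_on_cube_def)
  have sp: "space \<mu> = cube E" "sets \<mu> = Pow (cube E)" using assms by (auto simp: prob_on_cube_def)
  show ?thesis
  proof (rule integrable_const_bound[where B = "\<Sum>x\<in>cube E. \<bar>f x\<bar>"])
    show "AE x in \<mu>. norm (f x) \<le> (\<Sum>x\<in>cube E. \<bar>f x\<bar>)"
      using finite_cube[OF assms(1)] sp by (auto intro!: AE_I2 member_le_sum)
    show "f \<in> borel_measurable \<mu>" using sp by (auto simp: measurable_def)
  qed
qed

lemma integral_projected_law:
  fixes h :: "('i \<Rightarrow> real) \<Rightarrow> real"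
  assumes "space \<mu> = cube E" "sets \<mu> = Pow (cube E)" "E' \<subseteq> E"
  shows "(\<integral>y. h y \<partial>projected_law E' \<mu>) = (\<integral>x. h (restrict x E') \<partial>\<mu>)"
  unfolding projected_law_def
  using assms by (intro integral_distr) (auto simp: measurable_def intro: restrict_in_cube)

lemma integral_conditional_law:
  fixes h :: "('i \<Rightarrow> real) \<Rightarrow> real"
  assumes "prob_on_cube E \<mu>" and C: "C = agree_event \<mu> B \<eta>" "measure \<mu> C > 0"
  shows "(\<integral>y. h y \<partial>conditional_law E \<mu> B \<eta>)
           = (\<integral>x. indicator C x * h (restrict x (E - B)) \<partial>\<mu>) / measure \<mu> C"
proof -
  interpret prob_space \<mu> using assms by (simp add: prob_on_cube_def)
  have sp: "space \<mu> = cube E" "sets \<mu> = Pow (cube E)" using assms by (auto simp: prob_on_cube_def)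
  \<comment> \<open>A real-valued density turns integrals under the conditioned measure into
    ordinary integrals under \<open>\<mu>\<close>.\<close>
  have dens: "uniform_measure \<mu> C = density \<mu> (\<lambda>x. ennreal (indicator C x / measure \<mu> C))"
    unfolding uniform_measure_def emeasure_eq_measure
    using C(2) by (intro arg_cong[where f = "density \<mu>"] ext)
      (auto simp: indicator_def divide_ennreal simp flip: ennreal_1)
  have "(\<integral>y. h y \<partial>conditional_law E \<mu> B \<eta>) = (\<integral>x. h (restrict x (E - B)) \<partial>uniform_measure \<mu> C)"
    unfolding conditional_law_def C(1)[symmetric]
    by (rule integral_projected_law[where E = E]) (use sp in auto)
  also have "\<dots> = (\<integral>x. (indicator C x / measure \<mu> C) * h (restrict x (E - B)) \<partial>\<mu>)"
    unfolding dens by (subst integral_density) (auto simp: measurable_def sp)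
  also have "\<dots> = (\<integral>x. indicator C x * h (restrict x (E - B)) \<partial>\<mu>) / measure \<mu> C"
    by (simp flip: integral_divide_zero)
  finally show ?thesis .
qed

text \<open>\<open>c1\<close> and \<open>c0\<close> say that the conditional covariances given
  \<open>X = 1\<close> and \<open>X = 0\<close> are nonpositive, multiplied by the squared
  probabilities of these events so that null events are no exception. What remains of
  \<open>cov \<mu> f g\<close> is the covariance of the conditional means, whose sign is governed by
  \<open>cov \<mu> X f * cov \<mu> X g\<close>.\<close>

lemma cov_nonpos_of_split:
  fixes X f g :: "('i \<Rightarrow> real) \<Rightarrow> real"
  assumes E: "finite E" "prob_on_cube E \<mu>"
    and X: "\<And>x. x \<in> cube E \<Longrightarrow> X x = 0 \<or> X x = 1"
    and c1: "(\<integral>x. X x \<partial>\<mu>) * (\<integral>x. X x * (f x * g x) \<partial>\<mu>)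
              \<le> (\<integral>x. X x * f x \<partial>\<mu>) * (\<integral>x. X x * g x \<partial>\<mu>)"
    and c0: "(\<integral>x. 1 - X x \<partial>\<mu>) * (\<integral>x. (1 - X x) * (f x * g x) \<partial>\<mu>)
              \<le> (\<integral>x. (1 - X x) * f x \<partial>\<mu>) * (\<integral>x. (1 - X x) * g x \<partial>\<mu>)"
    and f: "cov \<mu> X f \<ge> 0" and g: "cov \<mu> X g \<le> 0"
  shows "cov \<mu> f g \<le> 0"
proof -
  interpret prob_space \<mu> using E by (simp add: prob_on_cube_def)
  have sp: "space \<mu> = cube E" "sets \<mu> = Pow (cube E)" using E by (auto simp: prob_on_cube_def)
  note int [simp] = integrable_cube[OF E]
  define p where "p = (\<integral>x. X x \<partial>\<mu>)"
  define q where "q = 1 - p"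
  define h where "h = (\<lambda>x. f x * g x)"
  define R1 where "R1 k = (\<integral>x. X x * k x \<partial>\<mu>)" for k
  define R0 where "R0 k = (\<integral>x. (1 - X x) * k x \<partial>\<mu>)" for k
  have q: "q = (\<integral>x. 1 - X x \<partial>\<mu>)" by (simp add: q_def p_def prob_space)
  have split: "(\<integral>x. k x \<partial>\<mu>) = R1 k + R0 k" for k
    unfolding R1_def R0_def
    by (subst Bochner_Integration.integral_add[symmetric]) (auto simp: algebra_simps)
  have X01: "0 \<le> X x" "0 \<le> 1 - X x" if "x \<in> space \<mu>" for x
    using X[of x] that sp by auto
  have p0: "0 \<le> p"
    unfolding p_def by (rule Bochner_Integration.integral_nonneg) (rule X01)
  have q0: "0 \<le> q"
    unfolding q by (rule Bochner_Integration.integral_nonneg) (rule X01)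
  have c1': "p * R1 h \<le> R1 f * R1 g"
    unfolding p_def R1_def h_def by (rule c1)
  have c0': "q * R0 h \<le> R0 f * R0 g"
    unfolding q R0_def h_def by (rule c0)
  \<comment> \<open>Since \<open>q = 1 - p\<close>, this expression is exactly
    \<open>cov \<mu> X f\<close>; likewise for \<open>g\<close> below.\<close>
  have f': "q * R1 f - p * R0 f \<ge> 0"
  proof -
    have "cov \<mu> X f = R1 f - p * (R1 f + R0 f)"
      unfolding cov_def R1_def p_def split[of f, unfolded R1_def] by (rule refl)
    then show ?thesis using f by (simp add: q_def algebra_simps)
  qed
  have g': "q * R1 g - p * R0 g \<le> 0"
  proof -
    have "cov \<mu> X g = R1 g - p * (R1 g + R0 g)"
      unfolding cov_def R1_def p_def split[of g, unfolded R1_def] by (rule refl)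
    then show ?thesis using g by (simp add: q_def algebra_simps)
  qed
  have "R1 h + R0 h \<le> (R1 f + R0 f) * (R1 g + R0 g)"
  proof -
    \<comment> \<open>If \<open>X\<close> is almost surely constant, one of \<open>R1\<close>,
      \<open>R0\<close> vanishes and \<open>c0'\<close> or \<open>c1'\<close> is already the claim.
      Otherwise \<open>p * q\<close>, the variance of \<open>X\<close>, can be cancelled.\<close>
    consider "p = 0" | "q = 0" | "p > 0" "q > 0" using p0 q0 by linarith
    then show ?thesis
    proof cases
      case 1
      have "AE x in \<mu>. X x = 0"
        using 1 unfolding p_def by (subst (asm) integral_nonneg_eq_0_iff_AE) (auto simp: X01)
      then have "R1 k = 0" for k
        unfolding R1_def by (intro integral_eq_zero_AE) auto
      then show ?thesis using c0' 1 by (simp add: q_def)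
    next
      case 2
      have "AE x in \<mu>. 1 - X x = 0"
        using 2 unfolding q by (subst (asm) integral_nonneg_eq_0_iff_AE) (use X01 in \<open>auto simp del: diff_ge_0_iff_ge\<close>)
      then have "R0 k = 0" for k
        unfolding R0_def by (intro integral_eq_zero_AE) auto
      then show ?thesis using c1' 2 by (simp add: q_def)
    next
      case 3
      have pq: "p + q = 1" by (simp add: q_def)
      have a: "q * (p * R1 h) \<le> q * (R1 f * R1 g)" and b: "p * (q * R0 h) \<le> p * (R0 f * R0 g)"
        using c1' c0' p0 q0 by (auto intro: mult_left_mono)
      have "p * q * (R1 h + R0 h) \<le> q * (R1 f * R1 g) + p * (R0 f * R0 g)"
        using a b by (simp add: algebra_simps)
      \<comment> \<open>Covariance of the conditional means, scaled by \<open>p * q\<close>: as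
        \<open>p + q = 1\<close>, the mixed terms cancel and the last summand is
        \<open>cov \<mu> X f * cov \<mu> X g\<close>.\<close>
      also have "\<dots> = p * q * ((R1 f + R0 f) * (R1 g + R0 g)) 
          + (q * R1 f - p * R0 f) * (q * R1 g - p * R0 g)"
      proof -
        have p: "p = 1 - q" using pq by simp
        show ?thesis unfolding p by algebra
      qed
      also have "\<dots> \<le> p * q * ((R1 f + R0 f) * (R1 g + R0 g))"
        using mult_nonneg_nonpos[OF f' g'] by simp
      finally show ?thesis using 3 by (simp add: mult_le_cancel_left_pos)
    qed
  qed
  then show ?thesis
    by (simp add: cov_def split[symmetric] h_def)
qed

section \<open>Slices, dependence on coordinates and layer-cake induction\<close>

lemma fun_upd_in_cube:
  "y \<in> cube (E - {e}) \<Longrightarrow> e \<in> E \<Longrightarrow> v \<in> {0, 1} \<Longrightarrow> y(e := v) \<in> cube E"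
  by (auto simp: cube_def PiE_iff extensional_def)

lemma restrict_fun_upd_cube:
  assumes "x \<in> cube E"
  shows "(restrict x (E - {e}))(e := x e) = x"
  using assms by (auto simp: cube_def PiE_iff extensional_def)

lemma mono_on_cube_slice:
  assumes "mono_on (cube E) f" "e \<in> E" "v \<in> {0, 1}"
  shows "mono_on (cube (E - {e})) (\<lambda>y. f (y(e := v)))"
  using assms fun_upd_in_cube[of _ E e v]
  by (auto intro!: mono_onI mono_onD[OF assms(1)] simp: le_fun_def)

lemma depends_only_on_mono: "depends_only_on E B f \<Longrightarrow> B \<subseteq> B' \<Longrightarrow> depends_only_on E B' f"
  unfolding depends_only_on_def by (meson subsetD)

lemma depends_only_on_slice:
  assumes "depends_only_on E B f" "e \<in> E" "v \<in> {0, 1}"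
  shows "depends_only_on (E - {e}) (B - {e}) (\<lambda>y. f (y(e := v)))"
  unfolding depends_only_on_def
proof (intro ballI impI)
  fix x y assume "x \<in> cube (E - {e})" "y \<in> cube (E - {e})" "\<forall>b\<in>B - {e}. x b = y b"
  then show "f (x(e := v)) = f (y(e := v))"
    using assms fun_upd_in_cube[of _ E e v] unfolding depends_only_on_def by simp
qed

lemma depends_only_on_constant:
  assumes "depends_only_on E B f" "B \<inter> E = {}"
  obtains c where "\<And>x. x \<in> cube E \<Longrightarrow> f x = c"
proof -
  have "f x = f (SOME x. x \<in> cube E)" if x: "x \<in> cube E" for x
  proof -
    \<comment> \<open>Off \<open>E\<close> all configurations are \<open>undefined\<close>, so any
      two points of the cube agree on \<open>B\<close>.\<close>
    have "cube E = cube E \<inter> {y. (\<forall>b\<in>B. x b = y b)}"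
      using assms(2) x by (auto simp: cube_def PiE_iff extensional_def)
    then show ?thesis
      using assms(1) x someI[of "\<lambda>x. x \<in> cube E"] unfolding depends_only_on_def by blast
  qed
  then show ?thesis using that by blast
qed

text \<open>Extension by zero is a monotone right inverse of restriction to \<open>B\<close>, and
  \<open>f'\<close> is \<open>f\<close> composed with it. Tracking \<open>V\<close> ensures that
  indicators factor through indicators.\<close>

lemma mono_on_cube_factor:
  fixes f :: "('i \<Rightarrow> real) \<Rightarrow> real"
  assumes "mono_on (cube E) f" "depends_only_on E B f" "B \<subseteq> E" "f ` cube E \<subseteq> V"
  obtains f' where "mono_on (cube B) f'" "\<And>x. x \<in> cube E \<Longrightarrow> f x = f' (restrict x B)"
    "f' ` cube B \<subseteq> V"
proof
  define ext where "ext y = (\<lambda>i. if i \<in> E - B then 0 else y i)" for y :: "'i \<Rightarrow> real"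
  have ext: "ext y \<in> cube E" if "y \<in> cube B" for y
    using that assms(3) by (auto simp: ext_def cube_def PiE_iff extensional_def)
  show "mono_on (cube B) (\<lambda>y. f (ext y))"
    by (intro mono_onI mono_onD[OF assms(1)] ext) (auto simp: ext_def le_fun_def)
  show "f x = f (ext (restrict x B))" if "x \<in> cube E" for x
  proof -
    have "\<forall>e\<in>B. x e = ext (restrict x B) e" by (simp add: ext_def)
    with that ext[OF restrict_in_cube[OF that assms(3)]] show ?thesis
      using assms(2) unfolding depends_only_on_def by blast
  qed
  show "(\<lambda>y. f (ext y)) ` cube B \<subseteq> V" using ext assms(4) by blast
qed

text \<open>
  Peeling off the top value \<open>M\<close> of \<open>f\<close> leaves \<open>min f M'\<close>, with \<open>M'\<close> the second
  largest value, plus a multiple of the indicator of \<open>f = M\<close>.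
\<close>

lemma mono_on_cube_induct [consumes 3, case_names const layer cong]:
  fixes f :: "('i \<Rightarrow> real) \<Rightarrow> real"
  assumes "finite E" "mono_on (cube E) f" "depends_only_on E B f"
    and const: "\<And>c. P (\<lambda>x. c)"
    and layer: "\<And>u a h. P u \<Longrightarrow> a \<ge> 0 \<Longrightarrow> mono_on (cube E) h \<Longrightarrow> depends_only_on E B h \<Longrightarrow>
                  h ` cube E \<subseteq> {0, 1} \<Longrightarrow> P (\<lambda>x. u x + a * h x)"
    and cong: "\<And>u v. P u \<Longrightarrow> (\<And>x. x \<in> cube E \<Longrightarrow> u x = v x) \<Longrightarrow> P v"
  shows "P f"
  using assms(2,3)
proof (induction "card (f ` cube E)" arbitrary: f rule: less_induct)
  case less
  let ?V = "f ` cube E"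
  have fin: "finite ?V" using finite_cube[OF assms(1)] by simp
  have ne: "?V \<noteq> {}" by (simp add: cube_def PiE_eq_empty_iff)
  define M where "M = Max ?V"
  have M: "M \<in> ?V" "\<And>x. x \<in> cube E \<Longrightarrow> f x \<le> M" using fin ne by (auto simp: M_def)
  show ?case
  proof (cases "?V = {M}")
    case True
    then have "M = f x" if "x \<in> cube E" for x
      using imageI[OF that, of f] by simp
    then show ?thesis using cong[OF const] by blast
  next
    case False
    define M' where "M' = Max (?V - {M})"
    have "M' \<in> ?V - {M}" unfolding M'_def using False fin ne by (intro Max_in) auto
    then have M': "M' \<in> ?V" "M' < M" using M(2) by force+
    \<comment> \<open>No value of \<open>f\<close> lies strictly between \<open>M'\<close> and
      \<open>M\<close>, so \<open>u\<close> differs from \<open>f\<close> only on the top level, by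
      \<open>M - M'\<close>.\<close>
    have le: "f x \<le> M'" if "x \<in> cube E" "f x \<noteq> M" for x
      unfolding M'_def using that fin by (intro Max_ge) auto
    define u where "u x = min (f x) M'" for x
    \<comment> \<open>On the cube this is the indicator of \<open>f x = M\<close>; the threshold
      form makes monotonicity immediate.\<close>
    define h where "h x = (if f x \<ge> M then 1 else 0 :: real)" for x
    have "u ` cube E \<subseteq> ?V - {M}" using M' by (auto simp: u_def min_def)
    then have "card (u ` cube E) < card ?V"
      by (meson M(1) card_Diff1_less card_mono fin finite_Diff order_le_less_trans)
    moreover have "mono_on (cube E) u"
      using less.prems(1) by (auto simp: u_def mono_on_def intro: min.coboundedI1)
    moreover have "depends_only_on E B u"
      using less.prems(2) unfolding depends_only_on_def u_def by metis
    ultimately have "P u" using less.hyps by blast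
    moreover have "h ` cube E \<subseteq> {0, 1}" by (auto simp: h_def)
    moreover have "mono_on (cube E) h"
      using less.prems(1) by (auto simp: h_def mono_on_def intro: order_trans)
    moreover have "depends_only_on E B h"
      using less.prems(2) unfolding depends_only_on_def h_def by metis
    ultimately have "P (\<lambda>x. u x + (M - M') * h x)"
      using M' by (intro layer) auto
    then show ?thesis
    proof (rule cong)
      fix x assume "x \<in> cube E"
      then show "u x + (M - M') * h x = f x"
        using M(2)[of x] le[of x] M'(2) by (cases "f x = M") (auto simp: u_def h_def)
    qed
  qed
qed

lemma cov_layer:
  fixes f g h :: "('i \<Rightarrow> real) \<Rightarrow> real"
  assumes "finite E" "prob_on_cube E \<mu>"
  shows "cov \<mu> (\<lambda>x. f x + a * h x) g = cov \<mu> f g + a * cov \<mu> h g"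
proof -
  note int = integrable_cube[OF assms]
  have "(\<integral>x. (f x + a * h x) * g x \<partial>\<mu>) = (\<integral>x. f x * g x + a * (h x * g x) \<partial>\<mu>)"
    by (simp add: algebra_simps)
  also have "\<dots> = (\<integral>x. f x * g x \<partial>\<mu>) + a * (\<integral>x. h x * g x \<partial>\<mu>)"
    by (simp add: int)
  finally show ?thesis by (simp add: cov_def int algebra_simps)
qed

section \<open>Classes with the Feder-Mihail property: choosing and conditioning on a
  coordinate\<close>

locale feder_mihail_class =
  fixes S :: "'i set \<Rightarrow> ('i \<Rightarrow> real) measure set"
  assumes prob: "\<mu> \<in> S E \<Longrightarrow> finite E \<and> E \<noteq> {} \<and> prob_on_cube E \<mu>"
    and conditioning: "closed_under_conditioning S"
    and projection: "closed_under_projection S"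
    and pairwise: "\<mu> \<in> S E \<Longrightarrow> pairwise_negative_correlations E \<mu>"
    and feder_mihail: "\<mu> \<in> S E \<Longrightarrow> increasing_event E A \<Longrightarrow>
           \<exists>e\<in>E. (\<integral>x. x e * indicator A x \<partial>\<mu>) \<ge> (\<integral>x. x e \<partial>\<mu>) * measure \<mu> A"
begin

text \<open>Applied to \<open>\<mu>\<close> itself, \<open>feder_mihail\<close> might return a
  coordinate outside \<open>B\<close>; applied to the law projected to \<open>B\<close>, it
  cannot.\<close>

lemma exists_nonneg_cov:
  assumes \<mu>: "\<mu> \<in> S E" and f: "mono_on (cube E) f" "depends_only_on E B f" "f ` cube E \<subseteq> {0, 1}"
    and B: "B \<subseteq> E" "B \<noteq> {}"
  obtains e where "e \<in> B" "cov \<mu> (\<lambda>x. x e) f \<ge> 0"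
proof -
  have sp: "space \<mu> = cube E" "sets \<mu> = Pow (cube E)"
    using prob[OF \<mu>] by (auto simp: prob_on_cube_def)
  let ?\<nu> = "projected_law B \<mu>"
  have \<nu>: "?\<nu> \<in> S B" using projection \<mu> B unfolding closed_under_projection_def by blast
  have sp\<nu>: "space ?\<nu> = cube B" "sets ?\<nu> = Pow (cube B)"
    using prob[OF \<nu>] by (auto simp: prob_on_cube_def)
  interpret \<nu>: prob_space ?\<nu> using prob[OF \<nu>] by (simp add: prob_on_cube_def)
  obtain f' where f': "mono_on (cube B) f'" "\<And>x. x \<in> cube E \<Longrightarrow> f x = f' (restrict x B)"
    "f' ` cube B \<subseteq> {0, 1}"
    using mono_on_cube_factor[OF f(1,2) B(1) f(3)] by blast
  \<comment> \<open>As \<open>f'\<close> is 0-1-valued, it is the indicator of \<open>A\<close>, and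
    its monotonicity makes \<open>A\<close> increasing.\<close>
  define A where "A = {y \<in> cube B. f' y = 1}"
  have ind: "indicator A y = f' y" if "y \<in> cube B" for y
    using that f'(3) by (auto simp: A_def indicator_def)
  have "increasing_event B A"
    unfolding increasing_event_def A_def
  proof (safe)
    fix x y assume xy: "x \<in> cube B" "f' x = 1" "y \<in> cube B" "x \<le> y"
    then have "1 \<le> f' y" using mono_onD[OF f'(1), of x y] by simp
    then show "f' y = 1" using f'(3) xy by (force simp: image_subset_iff)
  qed
  from feder_mihail[OF \<nu> this] obtain e where e: "e \<in> B"
    "(\<integral>y. y e * indicator A y \<partial>?\<nu>) \<ge> (\<integral>y. y e \<partial>?\<nu>) * measure ?\<nu> A" by blast
  have "measure ?\<nu> A = (\<integral>y. indicator A y \<partial>?\<nu>)"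
    using sp\<nu> by (simp add: A_def Int_absorb2)
  also have "\<dots> = (\<integral>y. f' y \<partial>?\<nu>)"
    by (rule Bochner_Integration.integral_cong) (auto simp: ind sp\<nu>)
  also have "\<dots> = (\<integral>x. f x \<partial>\<mu>)"
    unfolding integral_projected_law[OF sp B(1)]
    by (rule Bochner_Integration.integral_cong) (auto simp: f'(2) sp)
  finally have 1: "measure ?\<nu> A = (\<integral>x. f x \<partial>\<mu>)" .
  have 2: "(\<integral>y. y e \<partial>?\<nu>) = (\<integral>x. x e \<partial>\<mu>)"
    unfolding integral_projected_law[OF sp B(1)] using e by simp
  have "(\<integral>y. y e * indicator A y \<partial>?\<nu>) = (\<integral>y. y e * f' y \<partial>?\<nu>)"
    by (rule Bochner_Integration.integral_cong) (auto simp: ind sp\<nu>)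
  also have "\<dots> = (\<integral>x. x e * f x \<partial>\<mu>)"
    unfolding integral_projected_law[OF sp B(1)]
    by (rule Bochner_Integration.integral_cong) (use e in \<open>auto simp: f'(2) sp\<close>)
  finally have "cov \<mu> (\<lambda>x. x e) f \<ge> 0" using e(2) 1 2 by (simp add: cov_def)
  with e(1) show ?thesis by (rule that)
qed

text \<open>For \<open>C\<close> of positive probability this is the induction hypothesis for the
  conditional law, cleared of denominators; for a null \<open>C\<close> both sides are zero.
  \<open>E \<noteq> {e}\<close> makes \<open>{e}\<close> a proper subset, as closure under
  conditioning demands.\<close>

lemma conditional_cov_nonpos:
  assumes \<mu>: "\<mu> \<in> S E" and e: "e \<in> E" "E \<noteq> {e}" and v: "v \<in> {0, 1}"
    and C: "C = {x \<in> cube E. x e = v}"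
    and IH: "\<And>\<nu>. \<nu> \<in> S (E - {e}) \<Longrightarrow> cov \<nu> (\<lambda>y. f (y(e := v))) (\<lambda>y. g (y(e := v))) \<le> 0"
  shows "(\<integral>x. indicator C x \<partial>\<mu>) * (\<integral>x. indicator C x * (f x * g x) \<partial>\<mu>)
           \<le> (\<integral>x. indicator C x * f x \<partial>\<mu>) * (\<integral>x. indicator C x * g x \<partial>\<mu>)"
proof -
  have sp: "space \<mu> = cube E" "sets \<mu> = Pow (cube E)" and pr: "prob_on_cube E \<mu>"
    using prob[OF \<mu>] by (auto simp: prob_on_cube_def)
  interpret prob_space \<mu> using pr by (simp add: prob_on_cube_def)
  have Csets: "C \<in> sets \<mu>" using sp C by auto
  have m: "(\<integral>x. indicator C x \<partial>\<mu>) = measure \<mu> C"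
    using Csets sets.sets_into_space by (simp add: Int_absorb2)
  show ?thesis
  proof (cases "measure \<mu> C = 0")
    case True
    have "AE x in \<mu>. x \<notin> C"
      using Csets True by (intro AE_not_in) (simp add: null_sets_def emeasure_eq_measure)
    then have "(\<integral>x. indicator C x * k x \<partial>\<mu>) = 0" for k :: "_ \<Rightarrow> real"
      by (intro integral_eq_zero_AE) (auto simp: indicator_def)
    then show ?thesis using True m by simp
  next
    case False
    then have pos: "measure \<mu> C > 0" by (simp add: zero_less_measure_iff)
    define \<eta> where "\<eta> = (\<lambda>i\<in>{e}. v)"
    have Ca: "C = agree_event \<mu> {e} \<eta>" by (auto simp: C agree_event_def sp \<eta>_def)
    define \<nu> where "\<nu> = conditional_law E \<mu> {e} \<eta>"
    have "\<eta> \<in> cube {e}" using v by (auto simp: \<eta>_def cube_def)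
    moreover have "{e} \<subset> E" using e by auto
    ultimately have \<nu>: "\<nu> \<in> S (E - {e})"
      using conditioning \<mu> pos unfolding closed_under_conditioning_def \<nu>_def Ca by blast
    have int: "(\<integral>y. k (y(e := v)) \<partial>\<nu>) = (\<integral>x. indicator C x * k x \<partial>\<mu>) / measure \<mu> C"
      for k :: "_ \<Rightarrow> real"
    proof -
      \<comment> \<open>The conditional law forgets coordinate \<open>e\<close>; on
        \<open>C\<close>, restoring the value \<open>v\<close> recovers the configuration.\<close>
      have "(restrict x (E - {e}))(e := v) = x" if "x \<in> C" for x
        using restrict_fun_upd_cube[of x E e] that unfolding C by blast
      then have "(\<integral>x. indicator C x * k ((restrict x (E - {e}))(e := v)) \<partial>\<mu>)
          = (\<integral>x. indicator C x * k x \<partial>\<mu>)"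
        by (intro Bochner_Integration.integral_cong) (simp_all add: indicator_def del: fun_upd_restrict)
      then show ?thesis
        unfolding \<nu>_def integral_conditional_law[OF pr Ca pos] by simp
    qed
    have "cov \<nu> (\<lambda>y. f (y(e := v))) (\<lambda>y. g (y(e := v))) \<le> 0" by (rule IH[OF \<nu>])
    then have "(\<integral>x. indicator C x * (f x * g x) \<partial>\<mu>) / measure \<mu> C
        \<le> (\<integral>x. indicator C x * f x \<partial>\<mu>) / measure \<mu> C * ((\<integral>x. indicator C x * g x \<partial>\<mu>) / measure \<mu> C)"
      using int[of "\<lambda>x. f x * g x"] int[of f] int[of g] by (simp add: cov_def)
    then show ?thesis unfolding m using pos by (simp add: field_simps)
  qed
qed

text \<open>The inductive step shared by both inductions below: the pivot \<open>e\<close> must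
  correlate nonnegatively with \<open>f\<close> and nonpositively with \<open>g\<close>.\<close>

lemma cov_nonpos_step:
  assumes \<mu>: "\<mu> \<in> S E" and e: "e \<in> E" "E \<noteq> {e}"
    and f: "cov \<mu> (\<lambda>x. x e) f \<ge> 0" and g: "cov \<mu> (\<lambda>x. x e) g \<le> 0"
    and IH: "\<And>\<nu> v. \<nu> \<in> S (E - {e}) \<Longrightarrow> v \<in> {0, 1} \<Longrightarrow>
               cov \<nu> (\<lambda>y. f (y(e := v))) (\<lambda>y. g (y(e := v))) \<le> 0"
  shows "cov \<mu> f g \<le> 0"
proof -
  have E: "finite E" "prob_on_cube E \<mu>" and sp: "space \<mu> = cube E"
    using prob[OF \<mu>] by (auto simp: prob_on_cube_def)
  \<comment> \<open>\<open>X\<^sub>e\<close> and \<open>1 - X\<^sub>e\<close> are the indicators of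
    the two slices; the choice \<open>k = 1\<close> gives the slice probabilities.\<close>
  have i1: "(\<integral>x. x e * k x \<partial>\<mu>) = (\<integral>x. indicator {x \<in> cube E. x e = 1} x * k x \<partial>\<mu>)"
    for k :: "_ \<Rightarrow> real"
    using cube_values[OF _ e(1)]
    by (intro Bochner_Integration.integral_cong) (auto simp: sp indicator_def)
  have i0: "(\<integral>x. (1 - x e) * k x \<partial>\<mu>) = (\<integral>x. indicator {x \<in> cube E. x e = 0} x * k x \<partial>\<mu>)"
    for k :: "_ \<Rightarrow> real"
    using cube_values[OF _ e(1)]
    by (intro Bochner_Integration.integral_cong) (auto simp: sp indicator_def)
  note slice = conditional_cov_nonpos[OF \<mu> e _ refl IH]
  show ?thesis
  proof (rule cov_nonpos_of_split[OF E _ _ _ f g])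
    show "x e = 0 \<or> x e = 1" if "x \<in> cube E" for x using cube_values[OF that e(1)] .
    show "(\<integral>x. x e \<partial>\<mu>) * (\<integral>x. x e * (f x * g x) \<partial>\<mu>)
        \<le> (\<integral>x. x e * f x \<partial>\<mu>) * (\<integral>x. x e * g x \<partial>\<mu>)"
      using slice[of 1] i1[of "\<lambda>x. 1"] unfolding i1 mult_1_right by simp
    show "(\<integral>x. 1 - x e \<partial>\<mu>) * (\<integral>x. (1 - x e) * (f x * g x) \<partial>\<mu>)
        \<le> (\<integral>x. (1 - x e) * f x \<partial>\<mu>) * (\<integral>x. (1 - x e) * g x \<partial>\<mu>)"
      using slice[of 0] i0[of "\<lambda>x. 1"] unfolding i0 mult_1_right by simp
  qed
qed

section \<open>Induction on the number of coordinates, then passage to increasing functions\<close>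

lemma image_slice_subset:
  assumes "f ` cube E \<subseteq> V" "e \<in> E" "v \<in> {0, 1}"
  shows "(\<lambda>y. f (y(e := v))) ` cube (E - {e}) \<subseteq> V"
  using assms fun_upd_in_cube[of _ E e v] by blast

text \<open>The pivot \<open>d\<close> is sought among the coordinates other than \<open>e\<close>.
  Its correlation with the second function, a coordinate, is then controlled by
  \<open>pairwise\<close>, so the induction needs no input about general events.\<close>

lemma cov_coordinate_nonpos:
  assumes "\<mu> \<in> S E" "e \<in> E" "mono_on (cube E) f" "depends_only_on E (E - {e}) f"
    "f ` cube E \<subseteq> {0, 1}"
  shows "cov \<mu> f (\<lambda>x. x e) \<le> 0"
  using assms
proof (induction "card E" arbitrary: E \<mu> f rule: less_induct)
  case less
  have E: "finite E" "prob_on_cube E \<mu>" and sp: "space \<mu> = cube E" and ps: "prob_space \<mu>"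
    using prob[OF less.prems(1)] by (auto simp: prob_on_cube_def)
  show ?case
  proof (cases "E = {e}")
    case True
    obtain c where "\<And>x. x \<in> cube E \<Longrightarrow> f x = c"
      using depends_only_on_constant[OF less.prems(4)] True by blast
    then have "cov \<mu> f (\<lambda>x. x e) = cov \<mu> (\<lambda>x. c) (\<lambda>x. x e)"
      by (intro cov_cong) (auto simp: sp)
    then show ?thesis using cov_const_left[OF ps] by simp
  next
    case False
    then have "E - {e} \<noteq> {}" using less.prems(2) by auto
    from exists_nonneg_cov[OF less.prems(1,3,4,5) _ this]
    obtain d where d: "d \<in> E - {e}" "cov \<mu> (\<lambda>x. x d) f \<ge> 0" by blast
    have dE: "d \<in> E" "E \<noteq> {d}" using d less.prems(2) by auto
    show ?thesis
    proof (rule cov_nonpos_step[OF less.prems(1) dE d(2)])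
      show "cov \<mu> (\<lambda>x. x d) (\<lambda>x. x e) \<le> 0"
        using pairwise[OF less.prems(1)] d less.prems(2)
        by (auto simp: pairwise_negative_correlations_def cov_def)
      fix \<nu> :: "('i \<Rightarrow> real) measure" and v :: real assume \<nu>: "\<nu> \<in> S (E - {d})" and v: "v \<in> {0, 1}"
      have "cov \<nu> (\<lambda>y. f (y(d := v))) (\<lambda>y. y e) \<le> 0"
      proof (rule less.hyps[OF _ \<nu>])
        show "card (E - {d}) < card E" using E d by (intro card_Diff1_less) auto
        show "e \<in> E - {d}" using d less.prems by auto
        have "E - {e} - {d} = E - {d} - {e}" by auto
        then show "depends_only_on (E - {d}) (E - {d} - {e}) (\<lambda>y. f (y(d := v)))"
          using depends_only_on_slice[OF less.prems(4) dE(1) v] by simp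
      qed (fact mono_on_cube_slice[OF less.prems(3) dE(1) v] image_slice_subset[OF less.prems(5) dE(1) v])+
      \<comment> \<open>Because \<open>d \<noteq> e\<close>, slicing at \<open>d\<close> leaves the
        coordinate function of \<open>e\<close> unchanged.\<close>
      then show "cov \<nu> (\<lambda>y. f (y(d := v))) (\<lambda>y. (y(d := v)) e) \<le> 0" using d by auto
    qed
  qed
qed

text \<open>The pivot now comes from \<open>B\<close>, so \<open>g\<close> does not depend on it and
  \<open>cov_coordinate_nonpos\<close> supplies its nonpositive correlation with
  \<open>g\<close>.\<close>

lemma cov_indicators_nonpos:
  assumes "\<mu> \<in> S E" "B \<subseteq> E"
    "mono_on (cube E) f" "depends_only_on E B f" "f ` cube E \<subseteq> {0, 1}"
    "mono_on (cube E) g" "depends_only_on E (E - B) g" "g ` cube E \<subseteq> {0, 1}"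
  shows "cov \<mu> f g \<le> 0"
  using assms
proof (induction "card E" arbitrary: E B \<mu> f g rule: less_induct)
  case less
  have E: "finite E" "prob_on_cube E \<mu>" and sp: "space \<mu> = cube E" and ps: "prob_space \<mu>"
    using prob[OF less.prems(1)] by (auto simp: prob_on_cube_def)
  consider "B = {}" | "E = B" | "B \<noteq> {}" "E \<noteq> B" by blast
  then show ?case
  proof cases
    case 1
    obtain c where "\<And>x. x \<in> cube E \<Longrightarrow> f x = c"
      using depends_only_on_constant[OF less.prems(4)] 1 by blast
    then have "cov \<mu> f g = cov \<mu> (\<lambda>x. c) g"
      by (intro cov_cong) (auto simp: sp)
    then show ?thesis using cov_const_left[OF ps] by simp
  next
    case 2
    obtain c where "\<And>x. x \<in> cube E \<Longrightarrow> g x = c"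
      using depends_only_on_constant[OF less.prems(7)] 2 by blast
    then have "cov \<mu> g f = cov \<mu> (\<lambda>x. c) f"
      by (intro cov_cong) (auto simp: sp)
    then show ?thesis using cov_const_left[OF ps] by (simp add: cov_commute)
  next
    case 3
    from exists_nonneg_cov[OF less.prems(1,3,4,5,2) 3(1)]
    obtain e where e: "e \<in> B" "cov \<mu> (\<lambda>x. x e) f \<ge> 0" by blast
    \<comment> \<open>\<open>E = {e}\<close> would force \<open>B = E\<close>, which was treated
      separately.\<close>
    have eE: "e \<in> E" "E \<noteq> {e}" using e less.prems(2) 3 by auto
    show ?thesis
    proof (rule cov_nonpos_step[OF less.prems(1) eE e(2)])
      have "depends_only_on E (E - {e}) g"
        using e by (intro depends_only_on_mono[OF less.prems(7)]) auto
      then show "cov \<mu> (\<lambda>x. x e) g \<le> 0"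
        using cov_coordinate_nonpos[OF less.prems(1) eE(1) less.prems(6) _ less.prems(8)]
        by (simp add: cov_commute)
      fix \<nu> :: "('i \<Rightarrow> real) measure" and v :: real assume \<nu>: "\<nu> \<in> S (E - {e})" and v: "v \<in> {0, 1}"
      show "cov \<nu> (\<lambda>y. f (y(e := v))) (\<lambda>y. g (y(e := v))) \<le> 0"
      proof (rule less.hyps[OF _ \<nu>])
        show "card (E - {e}) < card E" using E eE by (intro card_Diff1_less) auto
        show "B - {e} \<subseteq> E - {e}" using less.prems by auto
        \<comment> \<open>Removing the pivot from both \<open>E\<close> and \<open>B\<close> keeps
          the two functions on complementary sets of coordinates.\<close>
        have "E - {e} - (B - {e}) = E - B - {e}" using e by auto
        then show "depends_only_on (E - {e}) (E - {e} - (B - {e})) (\<lambda>y. g (y(e := v)))"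
          using depends_only_on_slice[OF less.prems(7) eE(1) v] by simp
        show "depends_only_on (E - {e}) (B - {e}) (\<lambda>y. f (y(e := v)))"
          using depends_only_on_slice[OF less.prems(4) eE(1) v] .
      qed (fact mono_on_cube_slice[OF less.prems(3) eE(1) v] mono_on_cube_slice[OF less.prems(6) eE(1) v]
            image_slice_subset[OF less.prems(5) eE(1) v] image_slice_subset[OF less.prems(8) eE(1) v])+
    qed
  qed
qed

text \<open>Covariance is linear in each argument and vanishes on constants, and the layers carry
  nonnegative weights. So one argument at a time can be reduced to indicators of increasing
  events.\<close>

lemma cov_mono_nonpos:
  assumes \<mu>: "\<mu> \<in> S E" and B: "B \<subseteq> E"
    and f: "mono_on (cube E) f" "depends_only_on E B f"
    and g: "mono_on (cube E) g" "depends_only_on E (E - B) g"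
  shows "cov \<mu> f g \<le> 0"
proof -
  have E: "finite E" "prob_on_cube E \<mu>" and sp: "space \<mu> = cube E" and ps: "prob_space \<mu>"
    using prob[OF \<mu>] by (auto simp: prob_on_cube_def)
  have half: "cov \<mu> f h \<le> 0"
    if h: "mono_on (cube E) h" "depends_only_on E (E - B) h" "h ` cube E \<subseteq> {0, 1}" for h
    using E(1) f
  proof (induction rule: mono_on_cube_induct)
    case (layer u a k)
    then show ?case
      using cov_indicators_nonpos[OF \<mu> B layer(3-5) h]
      by (auto simp: cov_layer[OF E] intro!: add_nonpos_nonpos mult_nonneg_nonpos)
  next
    case (cong u v)
    then show ?case using cov_cong[of \<mu> u v h h] by (simp add: sp)
  qed (simp add: cov_const_left[OF ps])
  \<comment> \<open>With \<open>half\<close> covering all indicators against \<open>f\<close>, the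
    layers of \<open>g\<close> are peeled off in the first slot, where \<open>cov_layer\<close>
    applies.\<close>
  have "cov \<mu> g f \<le> 0"
    using E(1) g
  proof (induction rule: mono_on_cube_induct)
    case (layer u a k)
    then show ?case
      using half[OF layer(3-5)]
      by (auto simp: cov_layer[OF E] cov_commute[of _ k] intro!: add_nonpos_nonpos mult_nonneg_nonpos)
  next
    case (cong u v)
    then show ?case using cov_cong[of \<mu> u v f f] by (simp add: sp)
  qed (simp add: cov_const_left[OF ps])
  then show ?thesis by (simp add: cov_commute)
qed

end

theorem theorem1p3:
  fixes S :: "'i set \<Rightarrow> ('i \<Rightarrow> real) measure set"
  assumes "\<And>E \<mu>. \<mu> \<in> S E \<Longrightarrow> finite E \<and> E \<noteq> {} \<and> prob_on_cube E \<mu>"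
    and "closed_under_conditioning S"
    and "closed_under_projection S"
    and "\<And>E \<mu>. \<mu> \<in> S E \<Longrightarrow> pairwise_negative_correlations E \<mu>"
    and "\<And>E \<mu> A. \<mu> \<in> S E \<Longrightarrow> increasing_event E A \<Longrightarrow>
           \<exists>e\<in>E. (\<integral>x. x e * indicator A x \<partial>\<mu>) \<ge> (\<integral>x. x e \<partial>\<mu>) * measure \<mu> A"
  shows "\<forall>E. \<forall>\<mu>\<in>S E. negatively_associated E \<mu>"
proof -
  interpret feder_mihail_class S
    by (unfold_locales) (fact assms)+
  show ?thesis
    using cov_mono_nonpos by (force simp: negatively_associated_def cov_def)
qed

end
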